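(* Let $f,g$ satisfy Assumptions (A1)–(A4) of the context, let $h(z)=\|\nabla_y g(z)\|^2$, and let $\varepsilon,\alpha_b,w,t_{\max}>0$ and $\beta,\alpha_{\mathrm{ls}},\gamma\in(0,1)$. Suppose $h(z^0)\le\varepsilon^2$, and let $\{z^k\}_{k\ge0}$ be generated by the algorithm described in the context. Then the limit point $\bar z$ of any convergent subsequence of $\{z^k\}$ is a KKT point of the problem $$\min_{z\in\mathbb{R}^{n+m}} f(z)\quad\text{s.t.}\quad h(z)-\varepsilon^2\le0,$$ i.e. there exists $\lambda\ge0$ such that $\nabla f(\bar z)+\lambda\nabla h(\bar z)=0$, $h(\bar z)-\varepsilon^2\le0$, and $\lambda\,(h(\bar z)-\varepsilon^2)=0$.
   Context: Write $z=(x,y)\in\mathbb{R}^{n+m}$; $\|\cdot\|$ is the Euclidean norm; $f,g:\mathbb{R}^n\times\mathbb{R}^m\to\mathbb{R}$. $\nabla_y g(z)\in\mathbb{R}^m$ is the partial gradient in $y$, and $\nabla^2_{yx}g(z)\in\mathbb{R}^{m\times n}$, $\nabla^2_{yy}g(z)\in\mathbb{R}^{m\times m}$ are the Jacobians of $\nabla_y g$ with respect to $x$ and $y$. Assumptions: (A1) $f$ is continuously differentiable and $\nabla f$ is locally Lipschitz continuous. (A2) $g$ is twice continuously differentiable and $\nabla^2_{yx}g$, $\nabla^2_{yy}g$ are locally Lipschitz continuous. (A3) For all $z$ with $\nabla_y g(z)\ne0$, $\nabla_y g(z)\notin\mathcal{N}\big([\nabla^2_{yx}g(z)\ \ \nabla^2_{yy}g(z)]^\top\big)$,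 where $\mathcal{N}$ denotes the null space. (A4) $h$ is coercive: $h(z)\to\infty$ as $\|z\|\to\infty$. Algorithm: start from $z^0$ with $h(z^0)\le\varepsilon^2$. For $k=0,1,2,\dots$: 1. $\Delta z^k$ is the unique minimizer of $\tfrac12\|\Delta z+\nabla f(z^k)\|^2$ over $\Delta z\in\mathbb{R}^{n+m}$ subject to $\nabla h(z^k)^\top\Delta z+\alpha_b(h(z^k)-\varepsilon^2)\le-w\|\Delta z\|^2$. 2. (Backtracking) $t^k$ is the first element $t$ of the sequence $t_{\max},\beta t_{\max},\beta^2t_{\max},\dots$ for which both conditions hold: - Armijo: $f(z^k+t\Delta z^k)\le f(z^k)+\alpha_{\mathrm{ls}}\,t\,\nabla f(z^k)^\top\Delta z^k$; - safety: $h(z^k+t\Delta z^k)-\varepsilon^2\le(1-\gamma)(h(z^k)-\varepsilon^2)$. 3. $z^{k+1}=z^k+t^k\Delta z^k$. *)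

theory Defs
  imports "HOL-Analysis.Analysis"
begin

definition gradient :: "('a::real_inner \<Rightarrow> real) \<Rightarrow> 'a \<Rightarrow> 'a" where
  "gradient f z = (THE D. GDERIV f z :> D)"

definition continuously_differentiable ::
    "('a::real_normed_vector \<Rightarrow> 'b::real_normed_vector) \<Rightarrow> bool" where
  "continuously_differentiable F \<longleftrightarrow>
     (\<exists>F' :: 'a \<Rightarrow> 'a \<Rightarrow>\<^sub>L 'b.
        (\<forall>z. (F has_derivative blinfun_apply (F' z)) (at z)) \<and> continuous_on UNIV F')"

definition twice_continuously_differentiable ::
    "('a::real_normed_vector \<Rightarrow> 'b::real_normed_vector) \<Rightarrow> bool" where
  "twice_continuously_differentiable F \<longleftrightarrow>
     (\<exists>F' :: 'a \<Rightarrow> 'a \<Rightarrow>\<^sub>L 'b.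
        (\<forall>z. (F has_derivative blinfun_apply (F' z)) (at z)) \<and> continuously_differentiable F')"

definition locally_lipschitz :: "('a::metric_space \<Rightarrow> 'b::metric_space) \<Rightarrow> bool" where
  "locally_lipschitz F \<longleftrightarrow> (\<forall>z. \<exists>u>0. \<exists>L. L-lipschitz_on (cball z u) F)"

definition coercive :: "('a::real_normed_vector \<Rightarrow> real) \<Rightarrow> bool" where
  "coercive h \<longleftrightarrow> filterlim h at_top at_infinity"

text \<open>A point of \<open>\<real>\<^sup>n \<times> \<real>\<^sup>m\<close> is a pair; the library norm and inner product on pairs are the
  Euclidean ones.\<close>

definition grad_y :: "((real^'n) \<times> (real^'m) \<Rightarrow> real) \<Rightarrow> (real^'n) \<times> (real^'m) \<Rightarrow> real^'m" where
  "grad_y g z = gradient (\<lambda>y. g (fst z, y)) (snd z)"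

definition hess_yx :: "((real^'n) \<times> (real^'m) \<Rightarrow> real) \<Rightarrow> (real^'n) \<times> (real^'m) \<Rightarrow> real^'n^'m" where
  "hess_yx g z = jacobian (\<lambda>x. grad_y g (x, snd z)) (at (fst z))"

definition hess_yy :: "((real^'n) \<times> (real^'m) \<Rightarrow> real) \<Rightarrow> (real^'n) \<times> (real^'m) \<Rightarrow> real^'m^'m" where
  "hess_yy g z = jacobian (\<lambda>y. grad_y g (fst z, y)) (at (snd z))"

definition block_row :: "real^'n^'k \<Rightarrow> real^'m^'k \<Rightarrow> real^('n + 'm)^'k" where
  "block_row A B = (\<chi> i j. case j of Inl a \<Rightarrow> A $ i $ a | Inr b \<Rightarrow> B $ i $ b)"

definition null_space :: "real^'n^'k \<Rightarrow> (real^'n) set" where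
  "null_space A = {v. A *v v = 0}"

definition unique_minimizer :: "('a \<Rightarrow> real) \<Rightarrow> 'a set \<Rightarrow> 'a \<Rightarrow> bool" where
  "unique_minimizer F S d \<longleftrightarrow>
     is_arg_min F (\<lambda>e. e \<in> S) d \<and> (\<forall>e. is_arg_min F (\<lambda>e. e \<in> S) e \<longrightarrow> e = d)"

definition search_direction ::
    "('a::real_inner \<Rightarrow> real) \<Rightarrow> ('a \<Rightarrow> real) \<Rightarrow> real \<Rightarrow> real \<Rightarrow> real \<Rightarrow> 'a \<Rightarrow> 'a \<Rightarrow> bool" where
  "search_direction f h \<epsilon> \<alpha>\<^sub>b w z d \<longleftrightarrow>
     unique_minimizer (\<lambda>e. 1/2 * (norm (e + gradient f z))\<^sup>2)
       {e. gradient h z \<bullet> e + \<alpha>\<^sub>b * (h z - \<epsilon>\<^sup>2) \<le> - w * (norm e)\<^sup>2} d"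

definition step_acceptable ::
    "('a::real_inner \<Rightarrow> real) \<Rightarrow> ('a \<Rightarrow> real) \<Rightarrow> real \<Rightarrow> real \<Rightarrow> real \<Rightarrow> 'a \<Rightarrow> 'a \<Rightarrow> real \<Rightarrow> bool" where
  "step_acceptable f h \<epsilon> \<alpha>\<^sub>l\<^sub>s \<gamma> z d t \<longleftrightarrow>
     f (z + t *\<^sub>R d) \<le> f z + \<alpha>\<^sub>l\<^sub>s * t * (gradient f z \<bullet> d) \<and>
     h (z + t *\<^sub>R d) - \<epsilon>\<^sup>2 \<le> (1 - \<gamma>) * (h z - \<epsilon>\<^sup>2)"

definition backtracking_step :: "real \<Rightarrow> real \<Rightarrow> (real \<Rightarrow> bool) \<Rightarrow> real \<Rightarrow> bool" where
  "backtracking_step t\<^sub>m\<^sub>a\<^sub>x \<beta> acc t \<longleftrightarrow>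
     (\<exists>i. t = \<beta> ^ i * t\<^sub>m\<^sub>a\<^sub>x \<and> acc (\<beta> ^ i * t\<^sub>m\<^sub>a\<^sub>x) \<and> (\<forall>j<i. \<not> acc (\<beta> ^ j * t\<^sub>m\<^sub>a\<^sub>x)))"

definition algorithm_iterates ::
    "('a::real_inner \<Rightarrow> real) \<Rightarrow> ('a \<Rightarrow> real) \<Rightarrow> real \<Rightarrow> real \<Rightarrow> real \<Rightarrow> real \<Rightarrow> real \<Rightarrow> real \<Rightarrow> real \<Rightarrow>
     (nat \<Rightarrow> 'a) \<Rightarrow> bool" where
  "algorithm_iterates f h \<epsilon> \<alpha>\<^sub>b w t\<^sub>m\<^sub>a\<^sub>x \<beta> \<alpha>\<^sub>l\<^sub>s \<gamma> z \<longleftrightarrow>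
     (\<forall>k. \<exists>d t. search_direction f h \<epsilon> \<alpha>\<^sub>b w (z k) d \<and>
       backtracking_step t\<^sub>m\<^sub>a\<^sub>x \<beta> (step_acceptable f h \<epsilon> \<alpha>\<^sub>l\<^sub>s \<gamma> (z k) d) t \<and>
       z (Suc k) = z k + t *\<^sub>R d)"

end

theory Submission
  imports Defs
begin

text \<open>
  The search direction \<open>d\<close> at \<open>z\<close> is the projection of \<open>- gradient f z\<close> onto a convex set which
  contains \<open>0\<close> because the iterates stay feasible; hence \<open>gradient f z \<bullet> d \<le> - (norm d)\<^sup>2\<close>.
  Quadratic upper bounds for \<open>f\<close> and \<open>h\<close> near the limit point keep the accepted step sizes away from
  \<open>0\<close> along the subsequence: the term \<open>- w * (norm d)\<^sup>2\<close> in the constraint absorbs the quadratic error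
  of \<open>h\<close>. As \<open>f\<close> decreases along the iterates and converges along the subsequence, the directions of
  the subsequence tend to \<open>0\<close>. Passing to the limit in the variational inequality of the projection
  gives \<open>gradient f zbar \<bullet> v \<ge> 0\<close> for every strictly feasible \<open>v\<close>, and such \<open>v\<close> exist since
  \<open>gradient h \<noteq> 0\<close> on the boundary by (A3).
\<close>

section \<open>Gradients as representing vectors of derivatives\<close>

lemma gradient_eqI: "GDERIV f z :> D \<Longrightarrow> gradient f z = D"
  unfolding gradient_def
proof (rule the_equality)
  fix E assume "GDERIV f z :> D" "GDERIV f z :> E"
  then have "(\<lambda>v. v \<bullet> D) = (\<lambda>v. v \<bullet> E)"
    unfolding gderiv_def by (rule has_derivative_unique)
  then have "\<forall>v. v \<bullet> D = v \<bullet> E"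
    by (simp add: fun_eq_iff)
  then show "E = D"
    unfolding vector_eq_ldot by simp
qed

text \<open>Riesz representation in finite dimension: the vector \<open>adjoint f' 1\<close>
  represents the functional \<open>f'\<close>. Hence differentiability alone makes the definite
  description in \<open>gradient\<close> meaningful.\<close>

lemma GDERIV_gradient:
  fixes f :: "'a::euclidean_space \<Rightarrow> real"
  assumes "(f has_derivative f') (at z)"
  shows "GDERIV f z :> gradient f z"
proof -
  have "linear f'"
    using assms by (rule has_derivative_linear)
  then have "f' = (\<lambda>v. v \<bullet> adjoint f' 1)"
    by (simp add: adjoint_works fun_eq_iff)
  then have "GDERIV f z :> adjoint f' 1"
    using assms unfolding gderiv_def by metis
  then show ?thesis
    using gradient_eqI[of f z "adjoint f' 1"] by simp
qed

section \<open>Local quadratic bounds and the projection subproblem\<close>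

text \<open>The inequality of the descent lemma, localized. The constant is uniform in the base
  point as well as in the trial point, because the iterates at which it is applied move towards
  \<open>c\<close>.\<close>

definition quadratic_upper_bound_near :: "('a::real_inner \<Rightarrow> real) \<Rightarrow> 'a \<Rightarrow> bool" where
  "quadratic_upper_bound_near f c \<longleftrightarrow> (\<exists>u>0. \<exists>K. \<forall>x\<in>ball c u. \<forall>y\<in>ball c u.
     f y \<le> f x + gradient f x \<bullet> (y - x) + K * (norm (y - x))\<^sup>2)"

text \<open>Rests on the identity
  \<open>p * |x|^2 + q * |y|^2 - |p x + q y|^2 = p * q * |x - y|^2\<close> for
  \<open>p + q = 1\<close>, which makes the squared norm convex.\<close>

lemma convex_quadratic_constraint:
  fixes a :: "'a::real_inner"
  assumes "w \<ge> 0"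
  shows "convex {e. a \<bullet> e + s \<le> - w * (norm e)\<^sup>2}"
proof (rule convexI)
  fix x y :: 'a and p q :: real
  assume xy: "x \<in> {e. a \<bullet> e + s \<le> - w * (norm e)\<^sup>2}" "y \<in> {e. a \<bullet> e + s \<le> - w * (norm e)\<^sup>2}"
    and pq: "0 \<le> p" "0 \<le> q" "p + q = 1"
  let ?v = "p *\<^sub>R x + q *\<^sub>R y"
  have q: "q = 1 - p"
    using pq by simp
  have "p * (norm x)\<^sup>2 + q * (norm y)\<^sup>2 - (norm ?v)\<^sup>2 = p * q * (norm (x - y))\<^sup>2"
    unfolding q power2_norm_eq_inner
    by (simp add: inner_diff_left inner_diff_right inner_add_left inner_add_right inner_commute algebra_simps)
  then have "w * (norm ?v)\<^sup>2 \<le> w * (p * (norm x)\<^sup>2 + q * (norm y)\<^sup>2)"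
    using assms pq by (intro mult_left_mono) (smt (verit) mult_nonneg_nonneg zero_le_power2)
  moreover have "p * (a \<bullet> x + s) + q * (a \<bullet> y + s) \<le> p * (- w * (norm x)\<^sup>2) + q * (- w * (norm y)\<^sup>2)"
    using xy pq by (intro add_mono mult_left_mono) auto
  moreover have "a \<bullet> ?v + s = p * (a \<bullet> x + s) + q * (a \<bullet> y + s)"
    unfolding q by (simp add: inner_add_right algebra_simps)
  ultimately show "?v \<in> {e. a \<bullet> e + s \<le> - w * (norm e)\<^sup>2}"
    by (simp add: algebra_simps)
qed

text \<open>The obtuse-angle characterization of the projection of \<open>- gradient f z\<close>
  onto the closed convex constraint set of the subproblem.\<close>

lemma search_direction_variational:
  fixes z :: "'a::euclidean_space"
  assumes d: "search_direction f h \<epsilon> a w z d" and w: "w \<ge> 0"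
    and e: "gradient h z \<bullet> e + a * (h z - \<epsilon>\<^sup>2) \<le> - w * (norm e)\<^sup>2"
  shows "(gradient f z + d) \<bullet> (e - d) \<ge> 0"
proof -
  let ?S = "{e. gradient h z \<bullet> e + a * (h z - \<epsilon>\<^sup>2) \<le> - w * (norm e)\<^sup>2}"
  have m: "d \<in> ?S" "\<And>e. e \<in> ?S \<Longrightarrow> (norm (d + gradient f z))\<^sup>2 \<le> (norm (e + gradient f z))\<^sup>2"
    using d unfolding search_direction_def unique_minimizer_def is_arg_min_linorder by auto
  have "closed ?S"
    by (intro closed_Collect_le continuous_intros)
  moreover have "\<forall>e\<in>?S. dist (- gradient f z) d \<le> dist (- gradient f z) e"
  proof
    fix e assume "e \<in> ?S"
    from m(2)[OF this] have "norm (d + gradient f z) \<le> norm (e + gradient f z)"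
      by (rule power2_le_imp_le) simp
    moreover have "dist (- gradient f z) x = norm (x + gradient f z)" for x
      by (simp add: dist_norm norm_minus_commute[of "- gradient f z"])
    ultimately show "dist (- gradient f z) d \<le> dist (- gradient f z) e"
      by simp
  qed
  ultimately have "(- gradient f z - d) \<bullet> (e - d) \<le> 0"
    using e m(1) w by (intro any_closest_point_dot[of ?S] convex_quadratic_constraint) auto
  moreover have "- gradient f z - d = - (gradient f z + d)"
    by simp
  ultimately show ?thesis
    by (metis inner_minus_left neg_le_0_iff_le)
qed

lemma search_direction_constraint:
  assumes "search_direction f h \<epsilon> a w z d"
  shows "gradient h z \<bullet> d + a * (h z - \<epsilon>\<^sup>2) \<le> - w * (norm d)\<^sup>2"
  using assms unfolding search_direction_def unique_minimizer_def is_arg_min_def by auto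

text \<open>At a feasible \<open>z\<close> the zero direction is admissible, so it may be tested in
  the variational inequality. The norm bound then follows by Cauchy-Schwarz.\<close>

lemma search_direction_descent:
  fixes z :: "'a::euclidean_space"
  assumes d: "search_direction f h \<epsilon> a w z d" and "w \<ge> 0" "a \<ge> 0" "h z \<le> \<epsilon>\<^sup>2"
  shows "gradient f z \<bullet> d \<le> - (norm d)\<^sup>2" "norm d \<le> norm (gradient f z)"
proof -
  have "(gradient f z + d) \<bullet> (0 - d) \<ge> 0"
    using assms by (intro search_direction_variational[OF d]) (auto simp: mult_nonneg_nonpos)
  then show *: "gradient f z \<bullet> d \<le> - (norm d)\<^sup>2"
    by (simp add: inner_add_left power2_norm_eq_inner)
  have "norm d * norm d \<le> norm (gradient f z) * norm d"
    using * norm_cauchy_schwarz[of "- gradient f z" d] by (simp add: power2_eq_square)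
  then show "norm d \<le> norm (gradient f z)"
    by (cases "d = 0") auto
qed

section \<open>Step sizes of the backtracking line search\<close>

text \<open>Either the first trial \<open>tm\<close> is accepted, or the trial just before
  \<open>t\<close>, namely \<open>t / b\<close>, was rejected and hence exceeds
  \<open>s0\<close>.\<close>

lemma backtracking_step_lower_bound:
  assumes "backtracking_step tm b acc t" "0 < tm" "0 < b" "b < 1"
    and acc: "\<And>s. 0 < s \<Longrightarrow> s \<le> s0 \<Longrightarrow> acc s"
  shows "min tm (b * s0) \<le> t"
proof -
  obtain i where i: "t = b ^ i * tm" "\<And>j. j < i \<Longrightarrow> \<not> acc (b ^ j * tm)"
    using assms(1) unfolding backtracking_step_def by auto
  show "min tm (b * s0) \<le> t"
  proof (cases i)
    case 0
    then show ?thesis using i by simp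
  next
    case (Suc j)
    then have "\<not> acc (b ^ j * tm)"
      using i by simp
    then have "s0 < b ^ j * tm"
      using acc[of "b ^ j * tm"] assms by force
    then have "b * s0 < t"
      using i Suc assms by simp
    then show ?thesis by simp
  qed
qed

text \<open>Each bound on \<open>t\<close> pays for one error. With
  \<open>t * K \<le> 1 - \<alpha>\<close> the quadratic error of \<open>f\<close> fits into the
  Armijo slack; with \<open>t * K \<le> w\<close> the margin \<open>w * |d|^2\<close> absorbs that
  of \<open>h\<close>. What remains is \<open>(1 - t * a)\<close> times the nonpositive residual of
  \<open>h\<close>, and \<open>t * a \<le> \<gamma>\<close> compares it with the safety
  condition.\<close>

lemma step_acceptable_small:
  fixes z :: "'a::euclidean_space"
  assumes d: "search_direction f h \<epsilon> a w z d" and pos: "0 < w" "0 < a" and hz: "h z \<le> \<epsilon>\<^sup>2"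
    and f: "f (z + t *\<^sub>R d) \<le> f z + gradient f z \<bullet> (t *\<^sub>R d) + K * (norm (t *\<^sub>R d))\<^sup>2"
    and h: "h (z + t *\<^sub>R d) \<le> h z + gradient h z \<bullet> (t *\<^sub>R d) + K * (norm (t *\<^sub>R d))\<^sup>2"
    and t: "0 < t" "t * K \<le> 1 - \<alpha>" "t * K \<le> w" "t * a \<le> \<gamma>" and "\<alpha> < 1"
  shows "step_acceptable f h \<epsilon> \<alpha> \<gamma> z d t"
  unfolding step_acceptable_def
proof
  let ?n = "(norm d)\<^sup>2"
  have dd: "gradient f z \<bullet> d \<le> - ?n"
    using search_direction_descent[OF d] pos hz by simp
  have q: "K * (norm (t *\<^sub>R d))\<^sup>2 = t * (t * K * ?n)"
    by (simp add: power2_eq_square)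
  have "t * K * ?n \<le> (1 - \<alpha>) * ?n"
    using t by (intro mult_right_mono) auto
  also have "\<dots> \<le> (1 - \<alpha>) * - (gradient f z \<bullet> d)"
    using dd \<open>\<alpha> < 1\<close> by (intro mult_left_mono) auto
  finally have "t * (t * K * ?n) \<le> t * ((1 - \<alpha>) * - (gradient f z \<bullet> d))"
    using t by (intro mult_left_mono) auto
  then show "f (z + t *\<^sub>R d) \<le> f z + \<alpha> * t * (gradient f z \<bullet> d)"
    using f unfolding q by (simp add: algebra_simps)
  have "t * K * ?n \<le> w * ?n"
    using t by (intro mult_right_mono) auto
  then have "gradient h z \<bullet> d + t * K * ?n \<le> - a * (h z - \<epsilon>\<^sup>2)"
    using search_direction_constraint[OF d] by simp
  then have "t * (gradient h z \<bullet> d + t * K * ?n) \<le> t * (- a * (h z - \<epsilon>\<^sup>2))"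
    using t by (intro mult_left_mono) auto
  moreover have "t * a * (\<epsilon>\<^sup>2 - h z) \<le> \<gamma> * (\<epsilon>\<^sup>2 - h z)"
    using t hz by (intro mult_right_mono) auto
  ultimately show "h (z + t *\<^sub>R d) - \<epsilon>\<^sup>2 \<le> (1 - \<gamma>) * (h z - \<epsilon>\<^sup>2)"
    using h unfolding q by (simp add: algebra_simps)
qed

section \<open>From vanishing directions to a KKT multiplier\<close>

text \<open>Farkas' lemma for a single strict inequality. Split \<open>b\<close> into
  \<open>m *\<^sub>R a\<close> and an orthogonal part \<open>p\<close>: testing \<open>- a\<close>
  gives the sign of \<open>m\<close>, and directions close to \<open>- p\<close> force
  \<open>p = 0\<close>.\<close>

lemma nonneg_on_halfspace_imp_multiple:
  fixes a b :: "'a::real_inner"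
  assumes "a \<noteq> 0" and b: "\<And>v. a \<bullet> v < 0 \<Longrightarrow> b \<bullet> v \<ge> 0"
  shows "\<exists>l\<ge>0. b + l *\<^sub>R a = 0"
proof -
  define m where "m = (b \<bullet> a) / (a \<bullet> a)"
  define p where "p = b - m *\<^sub>R a"
  have aa: "a \<bullet> a > 0"
    using assms by simp
  have ap: "a \<bullet> p = 0"
    using aa by (simp add: p_def m_def inner_diff_right inner_commute)
  have "b \<bullet> (- a) \<ge> 0"
    using aa by (intro b) simp
  then have m: "m \<le> 0"
    using aa by (simp add: m_def divide_nonpos_pos)
  \<comment> \<open>The direction \<open>- p\<close> itself lies on the boundary of the open
    halfspace; subtracting \<open>s *\<^sub>R a\<close> pushes it inside, and \<open>s\<close> tends
    to 0 afterwards.\<close>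
  have "s * (a \<bullet> b) + p \<bullet> p \<le> 0" if "s > 0" for s
  proof -
    have "b \<bullet> (- p - s *\<^sub>R a) \<ge> 0"
      using aa ap that by (intro b) (simp add: inner_diff_right)
    moreover have "b = p + m *\<^sub>R a"
      by (simp add: p_def)
    then have "b \<bullet> p = p \<bullet> p"
      using ap by (metis inner_add_left inner_scaleR_left add.right_neutral mult_zero_right)
    ultimately show ?thesis
      by (simp add: inner_diff_right inner_commute)
  qed
  then have "\<forall>\<^sub>F s in at_right 0. s * (a \<bullet> b) + p \<bullet> p \<le> 0"
    by (auto simp: eventually_at_right_field intro!: exI[of _ 1])
  moreover have "((\<lambda>s. s * (a \<bullet> b) + p \<bullet> p) \<longlongrightarrow> 0 * (a \<bullet> b) + p \<bullet> p) (at_right 0)"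
    by (intro tendsto_intros)
  ultimately have "p \<bullet> p \<le> 0"
    using tendsto_upperbound[of _ _ "at_right (0::real)" 0] by fastforce
  then have "p = 0"
    by (metis inner_gt_zero_iff not_le)
  then show ?thesis
    using m by (intro exI[of _ "- m"]) (simp add: p_def)
qed

text \<open>The convergence argument for general \<open>f\<close> and \<open>h\<close>. The
  structure of the lower-level problem enters through local properties at \<open>zbar\<close>:
  continuity, quadratic bounds, and a nonzero constraint gradient when the constraint is
  active.\<close>

theorem KKT_of_limit_point:
  fixes f h :: "'a::euclidean_space \<Rightarrow> real"
  assumes cont: "isCont f zbar" "isCont h zbar" "isCont (gradient f) zbar" "isCont (gradient h) zbar"
    and quad: "quadratic_upper_bound_near f zbar" "quadratic_upper_bound_near h zbar"
    and regular: "h zbar = \<epsilon>\<^sup>2 \<Longrightarrow> gradient h zbar \<noteq> 0"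
    and params: "a > 0" "w > 0" "tm > 0" "0 < \<beta>" "\<beta> < 1" "0 < \<alpha>" "\<alpha> < 1" "0 < \<gamma>" "\<gamma> < 1"
    and init: "h (z 0) \<le> \<epsilon>\<^sup>2"
    and iterates: "algorithm_iterates f h \<epsilon> a w tm \<beta> \<alpha> \<gamma> z"
    and r: "strict_mono r" and lim: "(z \<circ> r) \<longlonglongrightarrow> zbar"
  shows "\<exists>l\<ge>0. gradient f zbar + l *\<^sub>R gradient h zbar = 0 \<and>
    h zbar - \<epsilon>\<^sup>2 \<le> 0 \<and> l * (h zbar - \<epsilon>\<^sup>2) = 0"
proof -
  obtain d t where d: "\<And>k. search_direction f h \<epsilon> a w (z k) (d k)"
    and t: "\<And>k. backtracking_step tm \<beta> (step_acceptable f h \<epsilon> \<alpha> \<gamma> (z k) (d k)) (t k)"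
    and z: "\<And>k. z (Suc k) = z k + t k *\<^sub>R d k"
    using iterates unfolding algorithm_iterates_def by metis
  have t_pos: "0 < t k" and t_acc: "step_acceptable f h \<epsilon> \<alpha> \<gamma> (z k) (d k) (t k)" for k
    using t[of k] params unfolding backtracking_step_def by auto
  have feas: "h (z k) \<le> \<epsilon>\<^sup>2" for k
  proof (induction k)
    case (Suc k)
    have "h (z (Suc k)) - \<epsilon>\<^sup>2 \<le> (1 - \<gamma>) * (h (z k) - \<epsilon>\<^sup>2)"
      using t_acc[of k] unfolding step_acceptable_def z by simp
    also have "\<dots> \<le> 0"
      using Suc params by (intro mult_nonneg_nonpos) auto
    finally show ?case by simp
  qed (rule init)
  note descent = search_direction_descent[OF d _ _ feas, OF less_imp_le less_imp_le, OF params(2,1)]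
  have decrease: "\<alpha> * t k * (norm (d k))\<^sup>2 \<le> f (z k) - f (z (Suc k))" for k
  proof -
    have "\<alpha> * t k * (gradient f (z k) \<bullet> d k) \<le> \<alpha> * t k * - (norm (d k))\<^sup>2"
      using descent(1) params t_pos[of k] by (intro mult_left_mono) auto
    moreover have "f (z (Suc k)) \<le> f (z k) + \<alpha> * t k * (gradient f (z k) \<bullet> d k)"
      using t_acc[of k] unfolding step_acceptable_def z by simp
    ultimately show ?thesis by simp
  qed
  have "f (z (Suc k)) \<le> f (z k)" for k
    using decrease[of k] params t_pos[of k]
    by (smt (verit) mult_nonneg_nonneg zero_le_power2)
  then have anti: "decseq (\<lambda>k. f (z k))"
    by (intro decseq_SucI)
  have lim': "(\<lambda>k. z (r k)) \<longlonglongrightarrow> zbar"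
    using lim by (simp add: o_def)
  \<comment> \<open>In order: the limits of \<open>f\<close>, \<open>h\<close>,
    \<open>gradient f\<close> and \<open>gradient h\<close> along the subsequence.\<close>
  note lims = cont[THEN isCont_tendsto_compose, OF lim']

  obtain u1 K1 where u1: "u1 > 0" "\<And>x y. x \<in> ball zbar u1 \<Longrightarrow> y \<in> ball zbar u1 \<Longrightarrow>
      f y \<le> f x + gradient f x \<bullet> (y - x) + K1 * (norm (y - x))\<^sup>2"
    using quad(1) unfolding quadratic_upper_bound_near_def by blast
  obtain u2 K2 where u2: "u2 > 0" "\<And>x y. x \<in> ball zbar u2 \<Longrightarrow> y \<in> ball zbar u2 \<Longrightarrow>
      h y \<le> h x + gradient h x \<bullet> (y - x) + K2 * (norm (y - x))\<^sup>2"
    using quad(2) unfolding quadratic_upper_bound_near_def by blast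
  \<comment> \<open>\<open>K\<close> serves both functions and is at least 1, so that dividing by it
    is safe. \<open>M\<close> eventually bounds \<open>gradient f\<close> along the subsequence, and
    therefore the directions. In \<open>s0\<close> the first three terms are the requirements of
    \<open>step_acceptable_small\<close>; the last keeps the displacement below
    \<open>u / 2\<close>, so trial points stay in the ball on which the quadratic bounds
    hold.\<close>
  define u where "u = min u1 u2"
  define K where "K = max 1 (max K1 K2)"
  define M where "M = norm (gradient f zbar) + 1"
  have pos: "u > 0" "K > 0" "M > 0"
    using u1 u2 by (auto simp: u_def K_def M_def add_nonneg_pos)
  define s0 where "s0 = min (min ((1 - \<alpha>) / K) (w / K)) (min (\<gamma> / a) (u / (2 * M)))"
  define t0 where "t0 = min tm (\<beta> * s0)"
  have "s0 > 0"
    using params pos by (simp add: s0_def)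
  then have "t0 > 0"
    using params by (simp add: t0_def)
  have "\<forall>\<^sub>F k in sequentially. dist (z (r k)) zbar < u / 2"
    using pos tendstoD[OF lim', of "u / 2"] by simp
  moreover have "\<forall>\<^sub>F k in sequentially. norm (gradient f (z (r k))) < M"
    using tendsto_norm[OF lims(3)] by (rule order_tendstoD) (simp add: M_def)
  ultimately have t_lower: "\<forall>\<^sub>F k in sequentially. t0 \<le> t (r k)"
  proof eventually_elim
    case (elim k)
    let ?z = "z (r k)" and ?d = "d (r k)"
    have dM: "norm ?d \<le> M"
      using descent(2)[of "r k"] elim by simp
    have "step_acceptable f h \<epsilon> \<alpha> \<gamma> ?z ?d s" if s: "0 < s" "s \<le> s0" for s
    proof (rule step_acceptable_small[OF d params(2,1) feas, where K = K])
      show "s * K \<le> 1 - \<alpha>" "s * K \<le> w" "s * a \<le> \<gamma>"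
        using s pos params by (auto simp: s0_def field_simps)
      have "s * norm ?d \<le> u / (2 * M) * M"
        using s dM pos by (intro mult_mono) (auto simp: s0_def)
      then have sd: "norm (s *\<^sub>R ?d) \<le> u / 2"
        using s pos by simp
      have "dist zbar (?z + s *\<^sub>R ?d) \<le> dist ?z zbar + norm (s *\<^sub>R ?d)"
        by (metis dist_add_cancel dist_commute dist_norm dist_triangle add_diff_cancel_left')
      then have "?z + s *\<^sub>R ?d \<in> ball zbar u"
        using sd elim by simp
      moreover have "?z \<in> ball zbar u"
        using elim pos by (simp add: dist_commute)
      ultimately have
        "f (?z + s *\<^sub>R ?d) \<le> f ?z + gradient f ?z \<bullet> (s *\<^sub>R ?d) + K1 * (norm (s *\<^sub>R ?d))\<^sup>2"
        "h (?z + s *\<^sub>R ?d) \<le> h ?z + gradient h ?z \<bullet> (s *\<^sub>R ?d) + K2 * (norm (s *\<^sub>R ?d))\<^sup>2"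
        using u1(2)[of ?z "?z + s *\<^sub>R ?d"] u2(2)[of ?z "?z + s *\<^sub>R ?d"] by (simp_all add: u_def)
      moreover have "K1 * (norm (s *\<^sub>R ?d))\<^sup>2 \<le> K * (norm (s *\<^sub>R ?d))\<^sup>2"
        "K2 * (norm (s *\<^sub>R ?d))\<^sup>2 \<le> K * (norm (s *\<^sub>R ?d))\<^sup>2"
        by (rule mult_right_mono; simp add: K_def)+
      ultimately show
        "f (?z + s *\<^sub>R ?d) \<le> f ?z + gradient f ?z \<bullet> (s *\<^sub>R ?d) + K * (norm (s *\<^sub>R ?d))\<^sup>2"
        "h (?z + s *\<^sub>R ?d) \<le> h ?z + gradient h ?z \<bullet> (s *\<^sub>R ?d) + K * (norm (s *\<^sub>R ?d))\<^sup>2"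
        by linarith+
    qed (use s params in auto)
    then show ?case
      unfolding t0_def by (rule backtracking_step_lower_bound[OF t params(3-5)])
  qed

  have "\<forall>\<^sub>F k in sequentially.
      (norm (d (r k)))\<^sup>2 \<le> (f (z (r k)) - f (z (r (Suc k)))) / (\<alpha> * t0)"
    using t_lower
  proof eventually_elim
    case (elim k)
    have "\<alpha> * t0 * (norm (d (r k)))\<^sup>2 \<le> \<alpha> * t (r k) * (norm (d (r k)))\<^sup>2"
      using elim params by (intro mult_right_mono mult_left_mono) auto
    also have "\<dots> \<le> f (z (r k)) - f (z (Suc (r k)))"
      by (rule decrease)
    \<comment> \<open>As \<open>Suc (r k) \<le> r (Suc k)\<close>, monotonicity of \<open>f\<close>
      along the whole sequence replaces the next iterate by the next member of the subsequence. The
      right-hand side then tends to 0 since both terms converge to \<open>f zbar\<close>.\<close>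
    also have "\<dots> \<le> f (z (r k)) - f (z (r (Suc k)))"
      using decseqD[OF anti, of "Suc (r k)" "r (Suc k)"] r
      by (simp add: Suc_leI strict_mono_Suc_iff)
    finally show ?case
      using \<open>t0 > 0\<close> params by (simp add: field_simps)
  qed
  moreover have "(\<lambda>k. (f (z (r k)) - f (z (r (Suc k)))) / (\<alpha> * t0)) \<longlonglongrightarrow> (f zbar - f zbar) / (\<alpha> * t0)"
    using \<open>t0 > 0\<close> params by (intro tendsto_intros lims LIMSEQ_Suc[OF lims(1)]) auto
  ultimately have "(\<lambda>k. (norm (d (r k)))\<^sup>2) \<longlonglongrightarrow> 0"
    by (intro tendsto_sandwich[of "\<lambda>_. 0" "\<lambda>k. (norm (d (r k)))\<^sup>2" sequentially]) auto
  then have "(\<lambda>k. sqrt ((norm (d (r k)))\<^sup>2)) \<longlonglongrightarrow> sqrt 0"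
    by (rule tendsto_real_sqrt)
  then have d_lim: "(\<lambda>k. d (r k)) \<longlonglongrightarrow> 0"
    by (simp add: tendsto_norm_zero_iff)

  \<comment> \<open>Strictness at \<open>zbar\<close> makes \<open>v\<close> admissible in the
    subproblem at \<open>z (r k)\<close> for all large \<open>k\<close>; the variational inequality
    then passes to the limit because \<open>d (r k)\<close> tends to 0.\<close>
  have stationary: "gradient f zbar \<bullet> v \<ge> 0"
    if v: "gradient h zbar \<bullet> v + a * (h zbar - \<epsilon>\<^sup>2) < - w * (norm v)\<^sup>2" for v
  proof -
    have "(\<lambda>k. gradient h (z (r k)) \<bullet> v + a * (h (z (r k)) - \<epsilon>\<^sup>2))
        \<longlonglongrightarrow> gradient h zbar \<bullet> v + a * (h zbar - \<epsilon>\<^sup>2)"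
      by (intro tendsto_intros lims)
    from order_tendstoD(2)[OF this v]
    have "\<forall>\<^sub>F k in sequentially. (gradient f (z (r k)) + d (r k)) \<bullet> (v - d (r k)) \<ge> 0"
      by eventually_elim (use params in \<open>auto intro!: search_direction_variational[OF d]\<close>)
    moreover have "(\<lambda>k. (gradient f (z (r k)) + d (r k)) \<bullet> (v - d (r k)))
        \<longlonglongrightarrow> (gradient f zbar + 0) \<bullet> (v - 0)"
      by (intro tendsto_intros lims d_lim)
    ultimately have "(gradient f zbar + 0) \<bullet> (v - 0) \<ge> 0"
      by (intro tendsto_lowerbound) auto
    then show ?thesis by simp
  qed
  \<comment> \<open>The sign of \<open>gradient f zbar \<bullet> v\<close> does not change under
    positive scaling, so strict feasibility is only asked of short multiples of \<open>v\<close>,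
    where the quadratic term is of higher order.\<close>
  have scaled: "gradient f zbar \<bullet> v \<ge> 0"
    if "\<forall>\<^sub>F s in at_right 0. gradient h zbar \<bullet> (s *\<^sub>R v) + a * (h zbar - \<epsilon>\<^sup>2) < - w * (norm (s *\<^sub>R v))\<^sup>2" for v
  proof -
    have "\<forall>\<^sub>F s::real in at_right 0. 0 < s"
      by (simp add: eventually_at_right_less)
    with that have "\<forall>\<^sub>F s::real in at_right 0. gradient f zbar \<bullet> v \<ge> 0"
    proof eventually_elim
      case (elim s)
      then have "0 \<le> gradient f zbar \<bullet> (s *\<^sub>R v)"
        by (intro stationary)
      then show ?case
        using \<open>0 < s\<close> by (simp add: zero_le_mult_iff)
    qed
    then show ?thesis by simp
  qed
  have feas_bar: "h zbar \<le> \<epsilon>\<^sup>2"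
    using lims(2) feas by (intro LIMSEQ_le_const2) auto
  show ?thesis
  proof (cases "h zbar = \<epsilon>\<^sup>2")
    case True
    \<comment> \<open>Active constraint: after division by \<open>s\<close> the strict inequality
      reads \<open>gradient h zbar \<bullet> v + w * s * |v|^2 < 0\<close>, true for small
      \<open>s\<close>.\<close>
    have "gradient f zbar \<bullet> v \<ge> 0" if v: "gradient h zbar \<bullet> v < 0" for v
    proof (rule scaled)
      have "((\<lambda>s. gradient h zbar \<bullet> v + w * s * (norm v)\<^sup>2) \<longlongrightarrow> gradient h zbar \<bullet> v + w * 0 * (norm v)\<^sup>2) (at_right 0)"
        by (intro tendsto_intros)
      then have "\<forall>\<^sub>F s in at_right 0. gradient h zbar \<bullet> v + w * s * (norm v)\<^sup>2 < 0"
        using v by (intro order_tendstoD) auto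
      moreover have "\<forall>\<^sub>F s::real in at_right 0. 0 < s"
        by (simp add: eventually_at_right_less)
      ultimately show "\<forall>\<^sub>F s in at_right 0.
          gradient h zbar \<bullet> (s *\<^sub>R v) + a * (h zbar - \<epsilon>\<^sup>2) < - w * (norm (s *\<^sub>R v))\<^sup>2"
      proof eventually_elim
        case (elim s)
        then have "s * (gradient h zbar \<bullet> v + w * s * (norm v)\<^sup>2) < 0"
          by (simp add: mult_pos_neg)
        then show ?case
          using True \<open>0 < s\<close> by (simp add: algebra_simps power2_eq_square abs_of_pos)
      qed
    qed
    from nonneg_on_halfspace_imp_multiple[OF regular[OF True] this] show ?thesis
      using True by auto
  next
    case False
    then have neg: "a * (h zbar - \<epsilon>\<^sup>2) < 0"
      using feas_bar params by (simp add: mult_pos_neg)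
    \<comment> \<open>Inactive constraint: the negative residual makes short multiples of every
      \<open>v\<close> strictly feasible. Taking \<open>v = - gradient f zbar\<close> gives a zero
      gradient and the multiplier 0.\<close>
    have "gradient f zbar \<bullet> v \<ge> 0" for v
    proof (rule scaled)
      have "((\<lambda>s. gradient h zbar \<bullet> (s *\<^sub>R v) + a * (h zbar - \<epsilon>\<^sup>2) + w * (norm (s *\<^sub>R v))\<^sup>2)
          \<longlongrightarrow> gradient h zbar \<bullet> (0 *\<^sub>R v) + a * (h zbar - \<epsilon>\<^sup>2) + w * (norm (0 *\<^sub>R v))\<^sup>2) (at_right 0)"
        by (intro tendsto_intros)
      then have "\<forall>\<^sub>F s in at_right 0.
          gradient h zbar \<bullet> (s *\<^sub>R v) + a * (h zbar - \<epsilon>\<^sup>2) + w * (norm (s *\<^sub>R v))\<^sup>2 < 0"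
        using neg by (intro order_tendstoD) auto
      then show "\<forall>\<^sub>F s in at_right 0.
          gradient h zbar \<bullet> (s *\<^sub>R v) + a * (h zbar - \<epsilon>\<^sup>2) < - w * (norm (s *\<^sub>R v))\<^sup>2"
        by eventually_elim simp
    qed
    from this[of "- gradient f zbar"] have "gradient f zbar \<bullet> gradient f zbar \<le> 0"
      by simp
    then have "gradient f zbar = 0"
      by (metis inner_gt_zero_iff not_le)
    then show ?thesis
      using feas_bar by (intro exI[of _ 0]) simp
  qed
qed

section \<open>Quadratic upper bounds from Lipschitz derivatives\<close>

text \<open>Mean value inequality for \<open>F\<close> minus its linearization: on the segment from
  \<open>x\<close> to \<open>y\<close> the derivative differs from \<open>F' x\<close> by at most
  \<open>L * norm (y - x)\<close> in operator norm. The sharper factor 1/2 is given up.\<close>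

lemma linearization_error_le:
  fixes F :: "'a::real_normed_vector \<Rightarrow> 'b::real_normed_vector"
  assumes der: "\<And>x. x \<in> S \<Longrightarrow> (F has_derivative F' x) (at x)" and "convex S"
    and lip: "\<And>x y v. x \<in> S \<Longrightarrow> y \<in> S \<Longrightarrow> norm (F' y v - F' x v) \<le> L * norm (y - x) * norm v"
    and xy: "x \<in> S" "y \<in> S" and L: "L \<ge> 0"
  shows "norm (F y - F x - F' x (y - x)) \<le> L * (norm (y - x))\<^sup>2"
proof -
  let ?T = "closed_segment x y"
  have T: "?T \<subseteq> S"
    using assms closed_segment_subset by blast
  have "norm (F y - F x - F' x (y - x)) \<le> norm (y - x) * (L * norm (y - x))"
  proof (rule differentiable_bound_linearization[where S = ?T and f' = F'])
    fix s :: real assume "s \<in> {0..1}"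
    then show "x + s *\<^sub>R (y - x) \<in> ?T"
      by (auto simp: closed_segment_image_interval algebra_simps)
  next
    fix p assume p: "p \<in> ?T"
    then show "(F has_derivative F' p) (at p within ?T)"
      using der T by (meson has_derivative_at_withinI subsetD)
    have "norm (p - x) \<le> norm (y - x)"
      using segment_bound1[OF p] by simp
    then have "norm (F' p v - F' x v) \<le> L * norm (y - x) * norm v" for v
      using lip[of x p v] xy p T L
      by (smt (verit) mult_left_mono mult_right_mono norm_ge_zero subsetD)
    then show "onorm (F' p - F' x) \<le> L * norm (y - x)"
      using L by (intro onorm_bound) auto
  qed simp
  then show ?thesis
    by (simp add: power2_eq_square mult_ac)
qed

lemma quadratic_upper_bound_near_lipschitz_gradient:
  fixes f :: "'a::real_inner \<Rightarrow> real"
  assumes "\<And>x. GDERIV f x :> gradient f x" "locally_lipschitz (gradient f)"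
  shows "quadratic_upper_bound_near f c"
proof -
  obtain u L where u: "u > 0" and L: "L-lipschitz_on (cball c u) (gradient f)"
    using assms(2) unfolding locally_lipschitz_def by blast
  have "f y \<le> f x + gradient f x \<bullet> (y - x) + L * (norm (y - x))\<^sup>2"
    if xy: "x \<in> ball c u" "y \<in> ball c u" for x y
  proof -
    have "norm (f y - f x - (y - x) \<bullet> gradient f x) \<le> L * (norm (y - x))\<^sup>2"
    proof (rule linearization_error_le[where S = "cball c u" and F' = "\<lambda>x v. v \<bullet> gradient f x"])
      fix p q v :: 'a assume "p \<in> cball c u" "q \<in> cball c u"
      then have "norm (gradient f q - gradient f p) \<le> L * norm (q - p)"
        using lipschitz_onD[OF L] by (simp add: dist_norm)
      then have "norm v * norm (gradient f q - gradient f p) \<le> norm v * (L * norm (q - p))"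
        by (intro mult_left_mono) auto
      then show "norm (v \<bullet> gradient f q - v \<bullet> gradient f p) \<le> L * norm (q - p) * norm v"
        using Cauchy_Schwarz_ineq2[of v "gradient f q - gradient f p"]
        by (simp add: inner_diff_right mult_ac)
    qed (use assms xy lipschitz_on_nonneg[OF L] in \<open>auto simp: gderiv_def\<close>)
    then show ?thesis
      by (simp add: abs_le_iff inner_commute)
  qed
  then show ?thesis
    unfolding quadratic_upper_bound_near_def using u by blast
qed

text \<open>Expand \<open>|G y|^2\<close> exactly around \<open>G x\<close>. The linearization error
  of \<open>G\<close> enters paired with \<open>G x\<close>, which is bounded by \<open>N\<close>,
  and \<open>|G y - G x|^2\<close> is controlled by the Lipschitz constant \<open>B\<close> of
  \<open>G\<close>. This gives \<open>K = 2 * N * L + B^2\<close>.\<close>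

lemma quadratic_upper_bound_norm_square:
  fixes G :: "'a::real_normed_vector \<Rightarrow> 'b::real_inner"
  assumes der: "\<And>x. x \<in> ball c u \<Longrightarrow> (G has_derivative G' x) (at x)"
    and lip: "\<And>x y v. x \<in> ball c u \<Longrightarrow> y \<in> ball c u \<Longrightarrow>
      norm (G' y v - G' x v) \<le> L * norm (y - x) * norm v"
    and u: "u > 0" and L: "L \<ge> 0"
  shows "\<exists>K. \<forall>x\<in>ball c u. \<forall>y\<in>ball c u.
    (norm (G y))\<^sup>2 \<le> (norm (G x))\<^sup>2 + 2 * (G x \<bullet> G' x (y - x)) + K * (norm (y - x))\<^sup>2"
proof -
  have c: "c \<in> ball c u"
    using u by simp
  \<comment> \<open>\<open>B\<close> bounds \<open>G'\<close> on the ball: its norm at the centre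
    plus the Lipschitz variation over the radius. \<open>N\<close> below bounds \<open>G\<close> in
    the same way.\<close>
  define B where "B = onorm (G' c) + L * u"
  have lin: "bounded_linear (G' c)"
    using der[OF c] by (rule has_derivative_bounded_linear)
  have B: "onorm (G' x) \<le> B" if x: "x \<in> ball c u" for x
  proof (rule onorm_bound)
    show "B \<ge> 0"
      using onorm_pos_le[OF lin] L u by (simp add: B_def)
    fix v :: 'a
    have "norm (x - c) \<le> u"
      using x by (simp add: dist_norm norm_minus_commute)
    then have "L * norm (x - c) * norm v \<le> L * u * norm v"
      using L by (intro mult_right_mono mult_left_mono) auto
    then have "norm (G' x v - G' c v) \<le> L * u * norm v"
      using lip[OF c x, of v] by linarith
    moreover have "norm (G' c v) \<le> onorm (G' c) * norm v"
      by (rule onorm[OF lin])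
    ultimately show "norm (G' x v) \<le> B * norm v"
      using norm_triangle_sub[of "G' x v" "G' c v"] by (simp add: B_def distrib_right)
  qed
  have G_lip: "norm (G y - G x) \<le> B * norm (y - x)" if "x \<in> ball c u" "y \<in> ball c u" for x y
    using that der B
    by (intro differentiable_bound[where S = "ball c u"]) (auto intro: has_derivative_at_withinI)
  define N where "N = norm (G c) + B * u"
  have B0: "B \<ge> 0"
    using onorm_pos_le[OF lin] L u by (simp add: B_def)
  have N: "norm (G x) \<le> N" if x: "x \<in> ball c u" for x
  proof -
    have "B * norm (x - c) \<le> B * u"
      using x B0 by (intro mult_left_mono) (auto simp: dist_norm norm_minus_commute)
    then show ?thesis
      using G_lip[OF c x] norm_triangle_sub[of "G x" "G c"] by (simp add: N_def)
  qed
  have "(norm (G y))\<^sup>2 \<le> (norm (G x))\<^sup>2 + 2 * (G x \<bullet> G' x (y - x)) + (2 * N * L + B\<^sup>2) * (norm (y - x))\<^sup>2"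
    if xy: "x \<in> ball c u" "y \<in> ball c u" for x y
  proof -
    let ?e = "G y - G x - G' x (y - x)"
    have "norm ?e \<le> L * (norm (y - x))\<^sup>2"
      using der lip xy L by (intro linearization_error_le[where S = "ball c u"]) auto
    then have "norm (G x) * norm ?e \<le> N * (L * (norm (y - x))\<^sup>2)"
      using N[OF xy(1)] by (intro mult_mono) (auto intro: order_trans[OF norm_ge_zero])
    then have e: "G x \<bullet> ?e \<le> N * (L * (norm (y - x))\<^sup>2)"
      using norm_cauchy_schwarz[of "G x" ?e] by linarith
    have "(norm (G y - G x))\<^sup>2 \<le> (B * norm (y - x))\<^sup>2"
      using G_lip[OF xy] by (intro power_mono) auto
    moreover have "(norm (G y))\<^sup>2 = (norm (G x))\<^sup>2 + 2 * (G x \<bullet> G' x (y - x)) + 2 * (G x \<bullet> ?e) + (norm (G y - G x))\<^sup>2"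
      by (simp add: power2_norm_eq_inner inner_diff_left inner_diff_right inner_commute algebra_simps)
    ultimately show ?thesis
      using e by (simp add: power_mult_distrib algebra_simps)
  qed
  then show ?thesis by blast
qed

section \<open>Derivatives of the partial gradient and of its squared norm\<close>

lemma bounded_bilinear_matrix_vector_mult:
  "bounded_bilinear ((*v) :: real^'n^'m \<Rightarrow> real^'n \<Rightarrow> real^'m)"
  unfolding bilinear_conv_bounded_bilinear[symmetric] bilinear_def
  by (auto intro!: linearI simp: algebra_simps matrix_vector_mult_add_rdistrib scaleR_matrix_vector_assoc
      matrix_vector_right_distrib matrix_vector_mult_scaleR)

lemma bounded_bilinear_vector_matrix_mult:
  "bounded_bilinear ((v*) :: real^'m \<Rightarrow> real^'n^'m \<Rightarrow> real^'n)"
  unfolding bilinear_conv_bounded_bilinear[symmetric] bilinear_def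
  by (auto intro!: linearI simp: vector_matrix_mult_def vec_eq_iff algebra_simps sum.distrib sum_distrib_left)

context
  fixes g :: "(real^'n) \<times> (real^'m) \<Rightarrow> real"
  assumes g: "twice_continuously_differentiable g"
begin

text \<open>Joint differentiability comes from writing \<open>grad_y g\<close> as a bounded linear
  map applied to the derivative of \<open>g\<close>. Restricting the joint derivative to each factor
  then identifies it with the two Hessian blocks, which are defined as partial Jacobians.\<close>

lemma grad_y_has_derivative:
  "(grad_y g has_derivative (\<lambda>v. hess_yx g z *v fst v + hess_yy g z *v snd v)) (at z)"
proof -
  obtain g' :: "(real^'n) \<times> (real^'m) \<Rightarrow> ((real^'n) \<times> (real^'m)) \<Rightarrow>\<^sub>L real"
    and g'' :: "(real^'n) \<times> (real^'m) \<Rightarrow>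
      ((real^'n) \<times> (real^'m)) \<Rightarrow>\<^sub>L (((real^'n) \<times> (real^'m)) \<Rightarrow>\<^sub>L real)"
    where g': "\<And>z. (g has_derivative blinfun_apply (g' z)) (at z)"
      and g'': "\<And>z. (g' has_derivative blinfun_apply (g'' z)) (at z)"
    using g unfolding twice_continuously_differentiable_def continuously_differentiable_def by blast
  \<comment> \<open>\<open>T\<close> sends a functional on the product to the vector that represents
    its restriction to the second factor.\<close>
  define T :: "(((real^'n) \<times> (real^'m)) \<Rightarrow>\<^sub>L real) \<Rightarrow> real^'m"
    where "T = (\<lambda>l. \<Sum>b\<in>Basis. blinfun_apply l (0, b) *\<^sub>R b)"
  have T: "bounded_linear T"
    unfolding T_def
    by (intro bounded_linear_sum bounded_linear_scaleR_const blinfun.bounded_linear_left)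
  have G: "grad_y g = (\<lambda>z. T (g' z))"
  proof
    fix z
    have "((\<lambda>y. g (fst z, y)) has_derivative (\<lambda>v. g' z (0, v))) (at (snd z))"
      by (rule has_derivative_compose[where f = "\<lambda>y. (fst z, y)" and g = g, unfolded fst_conv])
        (use g'[of z] in \<open>auto intro!: derivative_eq_intros\<close>)
    moreover from GDERIV_gradient[OF this]
    have "GDERIV (\<lambda>y. g (fst z, y)) (snd z) :> grad_y g z"
      unfolding grad_y_def .
    ultimately have "(\<lambda>v. g' z (0, v)) = (\<lambda>v. v \<bullet> grad_y g z)"
      unfolding gderiv_def by (rule has_derivative_unique)
    then show "grad_y g z = T (g' z)"
      unfolding T_def by (metis (no_types, lifting) euclidean_representation inner_commute sum.cong)
  qed
  define D where "D = (\<lambda>v. T (g'' z v))"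
  have D: "(grad_y g has_derivative D) (at z)"
    unfolding G D_def using bounded_linear.has_derivative[OF T g''] .
  have "((\<lambda>x. grad_y g (x, snd z)) has_derivative (\<lambda>v. D (v, 0))) (at (fst z))"
    by (rule has_derivative_compose[where f = "\<lambda>x. (x, snd z)" and g = "grad_y g"])
      (use D in \<open>auto intro!: derivative_eq_intros\<close>)
  moreover from this have "((\<lambda>x. grad_y g (x, snd z)) has_derivative (\<lambda>v. hess_yx g z *v v)) (at (fst z))"
    unfolding hess_yx_def using jacobian_works differentiable_def by blast
  ultimately have x: "(\<lambda>v. D (v, 0)) = (\<lambda>v. hess_yx g z *v v)"
    by (rule has_derivative_unique)
  have "((\<lambda>y. grad_y g (fst z, y)) has_derivative (\<lambda>v. D (0, v))) (at (snd z))"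
    by (rule has_derivative_compose[where f = "\<lambda>y. (fst z, y)" and g = "grad_y g"])
      (use D in \<open>auto intro!: derivative_eq_intros\<close>)
  moreover from this have "((\<lambda>y. grad_y g (fst z, y)) has_derivative (\<lambda>v. hess_yy g z *v v)) (at (snd z))"
    unfolding hess_yy_def using jacobian_works differentiable_def by blast
  ultimately have y: "(\<lambda>v. D (0, v)) = (\<lambda>v. hess_yy g z *v v)"
    by (rule has_derivative_unique)
  have "D v = D (fst v, 0) + D (0, snd v)" for v
    using linear_add[OF has_derivative_linear[OF D], of "(fst v, 0)" "(0, snd v)"] by simp
  then have "D = (\<lambda>v. hess_yx g z *v fst v + hess_yy g z *v snd v)"
    using x y by (metis (no_types))
  then show ?thesis
    using D by simp
qed

lemma GDERIV_norm_grad_y_square: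
  "GDERIV (\<lambda>z. (norm (grad_y g z))\<^sup>2) z :>
     2 *\<^sub>R (grad_y g z v* hess_yx g z, grad_y g z v* hess_yy g z)"
proof -
  have "((\<lambda>z. grad_y g z \<bullet> grad_y g z) has_derivative
      (\<lambda>v. grad_y g z \<bullet> (hess_yx g z *v fst v + hess_yy g z *v snd v)
         + (hess_yx g z *v fst v + hess_yy g z *v snd v) \<bullet> grad_y g z)) (at z)"
    by (intro has_derivative_inner grad_y_has_derivative)
  moreover have "(\<lambda>v. grad_y g z \<bullet> (hess_yx g z *v fst v + hess_yy g z *v snd v)
         + (hess_yx g z *v fst v + hess_yy g z *v snd v) \<bullet> grad_y g z)
      = (\<lambda>v. v \<bullet> 2 *\<^sub>R (grad_y g z v* hess_yx g z, grad_y g z v* hess_yy g z))"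
    by (rule ext) (simp add: inner_prod_def dot_lmul_matrix[symmetric] inner_add_right
        inner_commute[of "fst _"] inner_commute[of "snd _"] inner_commute[of "_ + _"])
  ultimately show ?thesis
    by (simp add: gderiv_def power2_norm_eq_inner)
qed

lemmas gradient_norm_grad_y_square = gradient_eqI[OF GDERIV_norm_grad_y_square]

end

section \<open>Verification of the local properties of \<open>f\<close> and \<open>h\<close>\<close>

text \<open>Links the two components of \<open>gradient h\<close>, up to the factor 2, with the null
  space in (A3): the entries indexed by \<open>Inl\<close> and \<open>Inr\<close> are those of
  \<open>v v* A\<close> and \<open>v v* B\<close>.\<close>

lemma transpose_block_row_mult_eq_0:
  assumes "v v* A = 0" "v v* B = 0"
  shows "transpose (block_row A B) *v v = 0"
proof -
  have "(transpose (block_row A B) *v v) $ j = 0" for j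
    using assms by (cases j)
      (simp_all add: block_row_def transpose_def matrix_vector_mult_def vector_matrix_mult_def vec_eq_iff mult.commute)
  then show ?thesis
    by (simp add: vec_eq_iff)
qed

lemma locally_lipschitz_isCont:
  assumes "locally_lipschitz F"
  shows "isCont F c"
proof -
  obtain u L where u: "u > 0" and "L-lipschitz_on (cball c u) F"
    using assms unfolding locally_lipschitz_def by blast
  then have "continuous_on (ball c u) F"
    by (meson ball_subset_cball continuous_on_subset lipschitz_on_continuous_on)
  then show ?thesis
    using u by (simp add: continuous_on_eq_continuous_at)
qed

lemma quadratic_upper_bound_near_norm_grad_y_square:
  fixes g :: "(real^'n) \<times> (real^'m) \<Rightarrow> real"
  assumes g: "twice_continuously_differentiable g"
    and yx: "locally_lipschitz (hess_yx g)" and yy: "locally_lipschitz (hess_yy g)"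
  shows "quadratic_upper_bound_near (\<lambda>z. (norm (grad_y g z))\<^sup>2) c"
proof -
  obtain u1 L1 where 1: "u1 > 0" "L1-lipschitz_on (cball c u1) (hess_yx g)"
    using yx unfolding locally_lipschitz_def by blast
  obtain u2 L2 where 2: "u2 > 0" "L2-lipschitz_on (cball c u2) (hess_yy g)"
    using yy unfolding locally_lipschitz_def by blast
  \<comment> \<open>The Lipschitz assumptions bound matrix norms; boundedness of the matrix-vector
    product turns them into bounds on the action on vectors.\<close>
  obtain K1 where K1: "K1 > 0" "\<And>(A :: real^'n^'m) v. norm (A *v v) \<le> norm A * norm v * K1"
    using bounded_bilinear.pos_bounded[OF bounded_bilinear_matrix_vector_mult] by blast
  obtain K2 where K2: "K2 > 0" "\<And>(A :: real^'m^'m) v. norm (A *v v) \<le> norm A * norm v * K2"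
    using bounded_bilinear.pos_bounded[OF bounded_bilinear_matrix_vector_mult] by blast
  define u where "u = min u1 u2"
  have u: "u > 0"
    using 1 2 by (simp add: u_def)
  have L0: "L1 \<ge> 0" "L2 \<ge> 0"
    using 1 2 lipschitz_on_nonneg by blast+
  let ?G' = "\<lambda>z v. hess_yx g z *v fst v + hess_yy g z *v snd v"
  have lip: "norm (?G' y v - ?G' x v) \<le> (L1 * K1 + L2 * K2) * norm (y - x) * norm v"
    if "x \<in> ball c u" "y \<in> ball c u" for x y v
  proof -
    have A: "norm (hess_yx g y - hess_yx g x) \<le> L1 * norm (y - x)"
      using lipschitz_onD[OF 1(2)] that by (simp add: u_def dist_norm)
    have B: "norm (hess_yy g y - hess_yy g x) \<le> L2 * norm (y - x)"
      using lipschitz_onD[OF 2(2)] that by (simp add: u_def dist_norm)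
    have "norm ((hess_yx g y - hess_yx g x) *v fst v) \<le> L1 * norm (y - x) * norm v * K1"
      using A K1(1) L0 norm_fst_le[of "fst v" "snd v"]
      by (intro order_trans[OF K1(2)] mult_right_mono mult_mono) auto
    moreover have "norm ((hess_yy g y - hess_yy g x) *v snd v) \<le> L2 * norm (y - x) * norm v * K2"
      using B K2(1) L0 norm_snd_le[of "snd v" "fst v"]
      by (intro order_trans[OF K2(2)] mult_right_mono mult_mono) auto
    moreover have "?G' y v - ?G' x v
        = (hess_yx g y - hess_yx g x) *v fst v + (hess_yy g y - hess_yy g x) *v snd v"
      by (simp add: matrix_vector_mult_diff_rdistrib)
    ultimately show ?thesis
      using norm_triangle_ineq[of "(hess_yx g y - hess_yx g x) *v fst v"
          "(hess_yy g y - hess_yy g x) *v snd v"]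
      by (simp add: algebra_simps)
  qed
  have "\<exists>K. \<forall>x\<in>ball c u. \<forall>y\<in>ball c u. (norm (grad_y g y))\<^sup>2
      \<le> (norm (grad_y g x))\<^sup>2 + 2 * (grad_y g x \<bullet> ?G' x (y - x)) + K * (norm (y - x))\<^sup>2"
    using K1 K2 L0
    by (intro quadratic_upper_bound_norm_square[OF grad_y_has_derivative[OF g] lip u]) auto
  moreover have "gradient (\<lambda>z. (norm (grad_y g z))\<^sup>2) x \<bullet> v = 2 * (grad_y g x \<bullet> ?G' x v)" for x v
    unfolding gradient_norm_grad_y_square[OF g]
    by (simp add: inner_prod_def dot_lmul_matrix inner_add_right)
  ultimately show ?thesis
    unfolding quadratic_upper_bound_near_def using u by auto
qed

theorem proposition2:
  fixes f g h :: "(real^'n) \<times> (real^'m) \<Rightarrow> real"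
    and z :: "nat \<Rightarrow> (real^'n) \<times> (real^'m)"
    and zbar :: "(real^'n) \<times> (real^'m)"
    and \<epsilon> \<alpha>\<^sub>b w t\<^sub>m\<^sub>a\<^sub>x \<beta> \<alpha>\<^sub>l\<^sub>s \<gamma> :: real
    and r :: "nat \<Rightarrow> nat"
  assumes h_def: "h = (\<lambda>z. (norm (grad_y g z))\<^sup>2)"
    and A1: "continuously_differentiable f" "locally_lipschitz (gradient f)"
    and A2: "twice_continuously_differentiable g"
      "locally_lipschitz (hess_yx g)" "locally_lipschitz (hess_yy g)"
    and A3: "\<And>z. grad_y g z \<noteq> 0 \<Longrightarrow>
      grad_y g z \<notin> null_space (transpose (block_row (hess_yx g z) (hess_yy g z)))"
    and A4: "coercive h"
    and params: "\<epsilon> > 0" "\<alpha>\<^sub>b > 0" "w > 0" "t\<^sub>m\<^sub>a\<^sub>x > 0"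
      "\<beta> \<in> {0<..<1}" "\<alpha>\<^sub>l\<^sub>s \<in> {0<..<1}" "\<gamma> \<in> {0<..<1}"
    and init: "h (z 0) \<le> \<epsilon>\<^sup>2"
    and iterates: "algorithm_iterates f h \<epsilon> \<alpha>\<^sub>b w t\<^sub>m\<^sub>a\<^sub>x \<beta> \<alpha>\<^sub>l\<^sub>s \<gamma> z"
    and subseq: "strict_mono r" "(z \<circ> r) \<longlonglongrightarrow> zbar"
  shows "\<exists>l\<ge>0. gradient f zbar + l *\<^sub>R gradient h zbar = 0 \<and>
    h zbar - \<epsilon>\<^sup>2 \<le> 0 \<and> l * (h zbar - \<epsilon>\<^sup>2) = 0"
proof -
  obtain f' where "\<And>x. (f has_derivative blinfun_apply (f' x)) (at x)"
    using A1(1) unfolding continuously_differentiable_def by blast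
  then have f: "GDERIV f x :> gradient f x" for x
    by (rule GDERIV_gradient)
  note grad_h = gradient_norm_grad_y_square[OF A2(1), folded h_def]
  have "isCont f zbar"
    using f has_derivative_continuous unfolding gderiv_def by blast
  moreover have "isCont h zbar"
    using GDERIV_norm_grad_y_square[OF A2(1)] has_derivative_continuous
    unfolding gderiv_def h_def by blast
  moreover have "isCont (gradient h) zbar"
  proof -
    have "isCont (grad_y g) zbar"
      using grad_y_has_derivative[OF A2(1)] has_derivative_continuous by blast
    then have "isCont (\<lambda>z. 2 *\<^sub>R (grad_y g z v* hess_yx g z, grad_y g z v* hess_yy g z)) zbar"
      using locally_lipschitz_isCont[OF A2(2)] locally_lipschitz_isCont[OF A2(3)]
      by (intro continuous_intros bounded_bilinear.continuous[OF bounded_bilinear_vector_matrix_mult])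
    moreover have "gradient h = (\<lambda>z. 2 *\<^sub>R (grad_y g z v* hess_yx g z, grad_y g z v* hess_yy g z))"
      by (rule ext) (rule grad_h)
    ultimately show ?thesis
      by (simp only:)
  qed
  \<comment> \<open>On the boundary \<open>grad_y g zbar\<close> has norm \<epsilon> > 0, so (A3)
    applies at \<open>zbar\<close> and excludes a vanishing gradient of \<open>h\<close>.\<close>
  moreover have "gradient h zbar \<noteq> 0" if "h zbar = \<epsilon>\<^sup>2"
  proof
    assume "gradient h zbar = 0"
    then have "grad_y g zbar v* hess_yx g zbar = 0" "grad_y g zbar v* hess_yy g zbar = 0"
      unfolding grad_h by (simp_all add: zero_prod_def)
    then have "grad_y g zbar \<in> null_space (transpose (block_row (hess_yx g zbar) (hess_yy g zbar)))"
      unfolding null_space_def mem_Collect_eq by (rule transpose_block_row_mult_eq_0)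
    moreover have "grad_y g zbar \<noteq> 0"
      using that params(1) by (auto simp: h_def)
    ultimately show False
      using A3 by blast
  qed
  moreover have "quadratic_upper_bound_near h zbar"
    unfolding h_def by (rule quadratic_upper_bound_near_norm_grad_y_square[OF A2])
  moreover have "quadratic_upper_bound_near f zbar"
    by (rule quadratic_upper_bound_near_lipschitz_gradient[OF f A1(2)])
  ultimately show ?thesis
    using params init iterates subseq locally_lipschitz_isCont[OF A1(2)]
    by (intro KKT_of_limit_point[where h = h and z = z and r = r]) auto
qed

end
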